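(* Let $a,b,c,d\ge 0$ be real numbers and set, for $t\in(0,\infty)$, \[ f_{a,b}(t)=t^{(1-a+b)/2}\frac{b(t^a-1)}{a(t^b-1)},\qquad f_{c,d}(t)=t^{(1-c+d)/2}\frac{d(t^c-1)}{c(t^d-1)}. \] (1) When $a\ge b$, $f_{a,b}\preceq f_{c,d}$ is equivalent to \[ (c,d)\in\{(x,y): x\ge a,\ 0\le y\le x-a+b\}. \] (2) When $a<b$, $f_{a,b}\preceq f_{c,d}$ is equivalent to \[ (c,d)\in\{(x,y): 0\le x\le y\le x-a+b,\ y\le b\}\cup\{(x,y):0\le y\le x\}. \]
   Context: Conventions: $(t^a-1)/a$ is read as $\log t$ when $a=0$ (both in numerators and, reciprocally, in denominators), and the functions are extended continuously to $t=1$ with value $1$; they are then continuous functions $(0,\infty)\to(0,\infty)$. A function $\varphi:\mathbb{R}\to\mathbb{C}$ is positive definite if for all positive integers $n$, all $x_1,\ldots,x_n\in\mathbb{R}$ and all $\alpha_1,\ldots,\alpha_n\in\mathbb{C}$, $\sum_{i,j=1}^n\alpha_i\overline{\alpha_j}\varphi(x_i-x_j)\ge 0$. Relation $\preceq$: for continuous $f,g:(0,\infty)\to(0,\infty)$ with $f(1)=g(1)=1$, $f\preceq g$ means that $x\mapsto f(e^x)/g(e^x)$ is positive definite on $\mathbb{R}$.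
   Formalization: The case a=b is moved from (1) to (2), i.e. (1) is proved for a>b and (2) for a≤b, because (1) fails for a=b>0: with a=b=1, c=d=1/2 both functions equal √t, yet (1/2,1/2) violates x≥a. *)

theory Defs
  imports "HOL-Analysis.Analysis"
begin

definition positive_definite :: "(real \<Rightarrow> complex) \<Rightarrow> bool" where
  "positive_definite \<phi> \<longleftrightarrow>
     (\<forall>n\<ge>1. \<forall>(x :: nat \<Rightarrow> real) (\<alpha> :: nat \<Rightarrow> complex).
        (\<Sum>i=1..n. \<Sum>j=1..n. \<alpha> i * cnj (\<alpha> j) * \<phi> (x i - x j)) \<in> \<real>\<^sub>\<ge>\<^sub>0)"

text \<open>The relation is meant for continuous functions from the positive half-line to itself that
  take the value 1 at 1; \<open>fab_pos\<close>, \<open>fab_1\<close> and \<open>continuous_on_fab\<close> below show that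
  \<open>fab a b\<close> is always such a function. Only the values at positive arguments matter.\<close>

definition preceq :: "(real \<Rightarrow> real) \<Rightarrow> (real \<Rightarrow> real) \<Rightarrow> bool" (infix "\<preceq>" 50) where
  "f \<preceq> g \<longleftrightarrow> positive_definite (\<lambda>x. complex_of_real (f (exp x) / g (exp x)))"

definition powq :: "real \<Rightarrow> real \<Rightarrow> real" where
  "powq a t = (if a = 0 then ln t else (t powr a - 1) / a)"

text \<open>The factor \<open>b (t\<^sup>a - 1) / (a (t\<^sup>b - 1))\<close> is grouped as \<open>((t\<^sup>a - 1) / a) / ((t\<^sup>b - 1) / b)\<close>, so that
  the convention for a zero exponent applies to numerator and denominator separately. The value
  at 1 is the continuous extension; the quotient itself would be \<open>0 / 0 = 0\<close> there.\<close>

definition fab :: "real \<Rightarrow> real \<Rightarrow> real \<Rightarrow> real" where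
  "fab a b t = (if t = 1 then 1 else t powr ((1 - a + b) / 2) * (powq a t / powq b t))"

lemma fab_1 [simp]: "fab a b 1 = 1"
  by (simp add: fab_def)

lemma fab_eq:
  assumes "a > 0" "b > 0" "t > 0" "t \<noteq> 1"
  shows "fab a b t = t powr ((1 - a + b) / 2) * (b * (t powr a - 1) / (a * (t powr b - 1)))"
  using assms by (simp add: fab_def powq_def)

lemma powq_pos:
  assumes "t > 1" shows "powq a t > 0"
proof (cases "a > 0")
  case True
  then have "t powr a > 1" using assms by (simp add: gr_one_powr)
  with True show ?thesis by (simp add: powq_def)
next
  case False
  show ?thesis
  proof (cases "a = 0")
    case True
    then show ?thesis using assms by (simp add: powq_def)
  next
    case nz: False
    with False have "t powr a < 1" using assms by (simp add: powr_less_one)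
    with False nz show ?thesis by (simp add: powq_def field_simps)
  qed
qed

lemma powq_neg:
  assumes "0 < t" "t < 1" shows "powq a t < 0"
proof -
  have "powq a t = - powq (- a) (inverse t)"
  proof -
    have "inverse t powr (- a) = t powr a"
      using assms by (simp add: inverse_powr powr_minus)
    moreover have "ln (inverse t) = - ln t" using assms by (simp add: ln_inverse)
    ultimately show ?thesis by (simp add: powq_def)
  qed
  moreover have "powq (- a) (inverse t) > 0"
    using assms by (intro powq_pos) (simp add: one_less_inverse)
  ultimately show ?thesis by simp
qed

lemma fab_pos:
  assumes "t > 0" shows "fab a b t > 0"
proof -
  consider "t = 1" | "t > 1" | "t < 1" by linarith
  then show ?thesis
  proof cases
    case 2
    then show ?thesis using powq_pos[of t a] powq_pos[of t b] by (simp add: fab_def)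
  next
    case 3
    then have "powq a t / powq b t > 0" using assms
      by (intro divide_neg_neg powq_neg)
    then show ?thesis using 3 assms by (simp add: fab_def del: times_divide_eq_right)
  qed simp
qed

lemma DERIV_powq_1: "(powq a has_real_derivative 1) (at 1)"
proof (cases "a = 0")
  case True
  have "(ln has_real_derivative 1) (at 1)" by (auto intro!: derivative_eq_intros)
  then show ?thesis using True by (simp add: powq_def[abs_def])
next
  case False
  have "((\<lambda>t. (t powr a - 1) / a) has_real_derivative 1) (at 1)"
    using False by (auto intro!: derivative_eq_intros)
  then show ?thesis using False by (simp add: powq_def[abs_def])
qed

lemma powq_at_1: "powq a 1 = 0"
  by (simp add: powq_def)

lemma isCont_powq: "t > 0 \<Longrightarrow> isCont (powq a) t"
  by (cases "a = 0") (auto simp: powq_def[abs_def] intro!: continuous_intros)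

lemma isCont_fab:
  assumes "t > 0" shows "isCont (fab a b) t"
proof (cases "t = 1")
  case True
  have q: "((\<lambda>s. powq c s / (s - 1)) \<longlongrightarrow> 1) (at 1)" for c
    using DERIV_powq_1[of c] by (simp add: has_field_derivative_iff powq_at_1)
  have p: "((\<lambda>s. s powr ((1 - a + b) / 2)) \<longlongrightarrow> 1 powr ((1 - a + b) / 2)) (at (1::real))"
    by (intro tendsto_intros) auto
  have "((\<lambda>s. s powr ((1 - a + b) / 2) * ((powq a s / (s - 1)) / (powq b s / (s - 1))))
          \<longlongrightarrow> 1 powr ((1 - a + b) / 2) * (1 / 1)) (at 1)"
    by (intro tendsto_mult p tendsto_divide q) auto
  moreover have "\<forall>\<^sub>F s in at 1.
      s powr ((1 - a + b) / 2) * ((powq a s / (s - 1)) / (powq b s / (s - 1))) = fab a b s"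
    by (auto simp: eventually_at_filter fab_def)
  ultimately have "(fab a b \<longlongrightarrow> 1) (at 1)"
    by (simp add: filterlim_cong)
  then show ?thesis using True by (simp add: isCont_def)
next
  case False
  have nz: "powq b t \<noteq> 0"
    using assms False powq_pos[of t b] powq_neg[of t b] by (cases "t > 1") auto
  have "isCont (\<lambda>s. s powr ((1 - a + b) / 2) * (powq a s / powq b s)) t"
    using assms nz by (intro continuous_intros isCont_powq) auto
  moreover have "\<forall>\<^sub>F s in nhds t. fab a b s = s powr ((1 - a + b) / 2) * (powq a s / powq b s)"
    using t1_space_nhds[OF False] by eventually_elim (simp add: fab_def)
  ultimately show ?thesis by (simp add: isCont_cong)
qed

lemma continuous_on_fab: "continuous_on {0<..} (fab a b)"
  by (intro continuous_at_imp_continuous_on ballI isCont_fab) auto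

text \<open>For \<open>a = b\<close> the function \<open>fab a b\<close> is the square root, whatever the common value, so
  that \<open>x \<ge> a\<close> cannot be a necessary condition: if the region
  \<open>{(x, y). x \<ge> a \<and> 0 \<le> y \<and> y \<le> x - a + b}\<close> is used for all \<open>a \<ge> b\<close>, the
  characterization is refuted by \<open>(a, b) = (1, 1)\<close>, \<open>(c, d) = (1/2, 1/2)\<close>.\<close>

lemma fab_diag: "t > 0 \<Longrightarrow> fab a a t = sqrt t"
  using powq_pos[of t a] powq_neg[of t a]
  by (cases t "1 :: real" rule: linorder_cases) (auto simp: fab_def powr_half_sqrt)

lemma positive_definite_1: "positive_definite (\<lambda>x. 1)"
  unfolding positive_definite_def
proof (intro allI impI)
  fix n :: nat and x :: "nat \<Rightarrow> real" and \<alpha> :: "nat \<Rightarrow> complex"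
  have "(\<Sum>i=1..n. \<Sum>j=1..n. \<alpha> i * cnj (\<alpha> j) * 1) = (\<Sum>i=1..n. \<alpha> i) * cnj (\<Sum>i=1..n. \<alpha> i)"
    by (simp add: sum_product cnj_sum)
  also have "\<dots> = complex_of_real ((norm (\<Sum>i=1..n. \<alpha> i))\<^sup>2)"
    by (simp only: complex_norm_square)
  finally show "(\<Sum>i=1..n. \<Sum>j=1..n. \<alpha> i * cnj (\<alpha> j) * 1) \<in> \<real>\<^sub>\<ge>\<^sub>0"
    by simp
qed

lemma fab_diag_preceq: "fab a a \<preceq> fab c c"
  using positive_definite_1 by (simp add: preceq_def fab_diag)

lemma weak_inequality_fails:
  "\<not> (\<forall>a\<ge>0. \<forall>b\<ge>0. \<forall>c\<ge>0. \<forall>d\<ge>0. a \<ge> b \<longrightarrow>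
       (fab a b \<preceq> fab c d \<longleftrightarrow> (c, d) \<in> {(x, y). x \<ge> a \<and> 0 \<le> y \<and> y \<le> x - a + b}))"
proof
  assume "\<forall>a\<ge>0. \<forall>b\<ge>0. \<forall>c\<ge>0. \<forall>d\<ge>0. a \<ge> b \<longrightarrow>
       (fab a b \<preceq> fab c d \<longleftrightarrow> (c, d) \<in> {(x, y). x \<ge> a \<and> 0 \<le> y \<and> y \<le> x - a + b})"
  from this[rule_format, of 1 1 "1/2" "1/2"] show False
    using fab_diag_preceq[of 1 "1/2"] by simp
qed

end

theory Submission
  imports Defs "HOL-Complex_Analysis.Complex_Analysis"
begin

text \<open>With \<open>sinhc y = sinh y / y\<close> one has
  \<open>fab a b (exp x) = exp (x / 2) * sinhc (a x / 2) / sinhc (b x / 2)\<close>, so the question is when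
  \<open>sinhc (a x) sinhc (d x) / (sinhc (b x) sinhc (c x))\<close> is positive definite. The answer, which
  unifies both cases of the theorem, is: iff \<open>max a d \<le> max b c\<close> and \<open>a + d \<le> b + c\<close>.

  Sufficiency: by the product formula for the sine, \<open>sinhc (a x) / sinhc (b x)\<close> with \<open>a \<le> b\<close> is a limit
  of products of factors \<open>q + (1 - q) / (1 + s\<^sup>2 x\<^sup>2)\<close> with \<open>0 \<le> q \<le> 1\<close>. The remaining case
  \<open>b < a, d\<close> is reduced to this one by repeatedly subtracting \<open>b\<close> from \<open>a\<close> and \<open>d\<close>; the value
  \<open>b = 0\<close> is reached as a limit.

  Necessity: a real even positive definite function is at most its value at 0, and comparing
  exponential growth gives \<open>a + d \<le> b + c\<close>. If \<open>f\<close> is positive definite and smooth then so is \<open>- f''\<close>,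
  hence the even part of the power series of \<open>y \<mapsto> f (\<i> y)\<close> has nonnegative coefficients and \<open>f\<close> cannot vanish
  at both \<open>\<plusminus> \<i> y\<close> within its disc of convergence. For \<open>d > max b c\<close> the zeros \<open>\<plusminus> \<i> \<pi> / d\<close> would lie in
  that disc.\<close>

section \<open>Positive definite functions generated by characters\<close>

text \<open>Inductive generation makes closure under products elementary: it replaces Schur's product
  theorem for positive definite functions.\<close>

inductive character_cone :: "(real \<Rightarrow> complex) \<Rightarrow> bool" where
  character: "character_cone (\<lambda>x. cis (s * x))"
| add: "character_cone f \<Longrightarrow> character_cone g \<Longrightarrow> character_cone (\<lambda>x. f x + g x)"
| scale: "character_cone f \<Longrightarrow> c \<ge> 0 \<Longrightarrow> character_cone (\<lambda>x. complex_of_real c * f x)"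
| limit: "(\<And>n::nat. character_cone (f n)) \<Longrightarrow> (\<And>x. (\<lambda>n. f n x) \<longlonglongrightarrow> g x) \<Longrightarrow> character_cone g"

lemma nonneg_Reals_mult_of_real:
  "c \<ge> 0 \<Longrightarrow> z \<in> \<real>\<^sub>\<ge>\<^sub>0 \<Longrightarrow> complex_of_real c * z \<in> \<real>\<^sub>\<ge>\<^sub>0"
  by (simp add: complex_nonneg_Reals_iff)

section \<open>Closure properties of positive definite functions and of the cone\<close>

lemma positive_definite_limit:
  assumes "\<And>n::nat. positive_definite (f n)" "\<And>x. (\<lambda>n. f n x) \<longlonglongrightarrow> g x"
  shows "positive_definite g"
  unfolding positive_definite_def
proof (intro allI impI)
  fix n :: nat and x :: "nat \<Rightarrow> real" and \<alpha> :: "nat \<Rightarrow> complex"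
  assume n: "1 \<le> n"
  have lim: "(\<lambda>m. \<Sum>i=1..n. \<Sum>j=1..n. \<alpha> i * cnj (\<alpha> j) * f m (x i - x j))
          \<longlonglongrightarrow> (\<Sum>i=1..n. \<Sum>j=1..n. \<alpha> i * cnj (\<alpha> j) * g (x i - x j))"
    by (intro tendsto_intros assms)
  have "(\<Sum>i=1..n. \<Sum>j=1..n. \<alpha> i * cnj (\<alpha> j) * f m (x i - x j)) \<in> \<real>\<^sub>\<ge>\<^sub>0" for m
    using assms(1)[of m] n by (simp add: positive_definite_def)
  then show "(\<Sum>i=1..n. \<Sum>j=1..n. \<alpha> i * cnj (\<alpha> j) * g (x i - x j)) \<in> \<real>\<^sub>\<ge>\<^sub>0"
    by (rule closed_sequentially[OF closed_nonneg_Reals_complex _ lim])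
qed

lemma positive_definite_scale:
  assumes "positive_definite f" "c \<ge> 0"
  shows "positive_definite (\<lambda>x. complex_of_real c * f x)"
  unfolding positive_definite_def
proof (intro allI impI)
  fix n :: nat and x :: "nat \<Rightarrow> real" and \<alpha> :: "nat \<Rightarrow> complex"
  assume "1 \<le> n"
  then have "complex_of_real c * (\<Sum>i=1..n. \<Sum>j=1..n. \<alpha> i * cnj (\<alpha> j) * f (x i - x j)) \<in> \<real>\<^sub>\<ge>\<^sub>0"
    using assms by (intro nonneg_Reals_mult_of_real) (auto simp: positive_definite_def)
  then show "(\<Sum>i=1..n. \<Sum>j=1..n. \<alpha> i * cnj (\<alpha> j) * (complex_of_real c * f (x i - x j))) \<in> \<real>\<^sub>\<ge>\<^sub>0"
    by (simp add: sum_distrib_left mult_ac)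
qed

lemma positive_definite_add:
  assumes "positive_definite f" "positive_definite g"
  shows "positive_definite (\<lambda>x. f x + g x)"
  using assms
  by (simp add: positive_definite_def distrib_left sum.distrib)

lemma positive_definite_character: "positive_definite (\<lambda>x. cis (s * x))"
  unfolding positive_definite_def
proof (intro allI impI)
  fix n :: nat and x :: "nat \<Rightarrow> real" and \<alpha> :: "nat \<Rightarrow> complex"
  define w where "w = (\<Sum>i=1..n. \<alpha> i * cis (s * x i))"
  have "cis (s * (x i - x j)) = cis (s * x i) * cnj (cis (s * x j))" for i j
    by (simp add: cis_cnj cis_mult right_diff_distrib)
  then have "(\<Sum>i=1..n. \<Sum>j=1..n. \<alpha> i * cnj (\<alpha> j) * cis (s * (x i - x j))) = w * cnj w"
    by (simp add: w_def sum_product mult_ac)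
  also have "\<dots> = complex_of_real ((norm w)\<^sup>2)"
    by (simp only: complex_norm_square)
  finally show "(\<Sum>i=1..n. \<Sum>j=1..n. \<alpha> i * cnj (\<alpha> j) * cis (s * (x i - x j))) \<in> \<real>\<^sub>\<ge>\<^sub>0"
    by simp
qed

lemma character_cone_imp_positive_definite: "character_cone f \<Longrightarrow> positive_definite f"
proof (induction rule: character_cone.induct)
  case (limit f g)
  then show ?case using positive_definite_limit by blast
qed (auto intro: positive_definite_character positive_definite_add positive_definite_scale)

text \<open>Closure under products takes two nested inductions, one for each factor. This is the
  inner one, and it serves as the base case of \<open>character_cone_mult\<close>.\<close>

lemma character_cone_mult_character:
  assumes "character_cone g"
  shows "character_cone (\<lambda>x. cis (s * x) * g x)"
  using assms
proof (induction rule: character_cone.induct)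
  case (character t)
  then show ?case
    using character_cone.character[of "s + t"] by (simp add: cis_mult distrib_right)
next
  case (add f g)
  then show ?case using character_cone.add[OF add.IH] by (simp add: distrib_left)
next
  case (scale f c)
  then show ?case using character_cone.scale[of "\<lambda>x. cis (s * x) * f x" c] by (simp add: mult_ac)
next
  case (limit f g)
  show ?case
    by (rule character_cone.limit[where f = "\<lambda>n x. cis (s * x) * f n x"]) (intro tendsto_intros limit)+
qed

lemma character_cone_mult:
  assumes "character_cone f" "character_cone g"
  shows "character_cone (\<lambda>x. f x * g x)"
  using assms(1)
proof (induction rule: character_cone.induct)
  case (character s)
  then show ?case using character_cone_mult_character[OF assms(2)] .
next
  case (add f g)
  then show ?case using character_cone.add[OF add.IH] by (simp add: distrib_right)
next
  case (scale h c)
  then show ?case using character_cone.scale[of "\<lambda>x. h x * g x" c] by (simp add: mult_ac)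
next
  case (limit f h)
  show ?case
    by (rule character_cone.limit[where f = "\<lambda>n x. f n x * g x"]) (intro tendsto_intros limit)+
qed

lemma character_cone_const: "c \<ge> 0 \<Longrightarrow> character_cone (\<lambda>x. complex_of_real c)"
  using character_cone.scale[OF character_cone.character[of 0], of c] by simp

lemma character_cone_sum:
  fixes f :: "nat \<Rightarrow> real \<Rightarrow> complex"
  shows "(\<And>k. character_cone (f k)) \<Longrightarrow> character_cone (\<lambda>x. \<Sum>k<n. f k x)"
  using character_cone_const[of 0] by (induction n) (auto intro: character_cone.add)

lemma character_cone_prod:
  fixes f :: "nat \<Rightarrow> real \<Rightarrow> complex"
  shows "(\<And>k. character_cone (f k)) \<Longrightarrow> character_cone (\<lambda>x. \<Prod>k=1..n. f k x)"
  using character_cone_const[of 1] by (induction n) (auto intro: character_cone_mult)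

text \<open>The geometric series exhibits the function as a limit of sums of characters with
  nonnegative coefficients \<open>r ^ k\<close>.\<close>

lemma character_cone_geometric:
  assumes "0 \<le> r" "r < 1"
  shows "character_cone (\<lambda>x. 1 / (1 - complex_of_real r * cis (s * x)))"
proof (rule character_cone.limit)
  fix n :: nat
  have "character_cone (\<lambda>x. complex_of_real (r ^ k) * cis (real k * s * x))" for k
    using assms by (intro character_cone.scale character_cone.character) auto
  then have "character_cone (\<lambda>x. \<Sum>k<n. complex_of_real (r ^ k) * cis (real k * s * x))"
    by (rule character_cone_sum)
  then show "character_cone (\<lambda>x. \<Sum>k<n. (complex_of_real r * cis (s * x)) ^ k)"
    by (simp add: power_mult_distrib Complex.DeMoivre mult.assoc)
next
  fix x
  have "norm (complex_of_real r * cis (s * x)) < 1"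
    using assms by (simp add: norm_mult)
  then show "(\<lambda>n. \<Sum>k<n. (complex_of_real r * cis (s * x)) ^ k)
               \<longlonglongrightarrow> 1 / (1 - complex_of_real r * cis (s * x))"
    using geometric_sums[of "complex_of_real r * cis (s * x)"] by (simp add: sums_def)
qed

text \<open>The Fourier transform of the exponential density, obtained from its discrete analogue: the
  geometric distribution with ratio \<open>1 - h\<close> on the lattice of mesh \<open>h\<close>, as \<open>h\<close> tends to 0.\<close>

lemma character_cone_exponential:
  "character_cone (\<lambda>x. 1 / (1 - \<i> * complex_of_real (s * x)))"
proof (rule character_cone.limit)
  fix n :: nat
  show "character_cone (\<lambda>x. complex_of_real (inverse (real (Suc n)))
          * (1 / (1 - complex_of_real (1 - inverse (real (Suc n))) * cis (inverse (real (Suc n)) * s * x))))"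
    by (intro character_cone.scale character_cone_geometric) (auto simp: field_simps)
next
  fix x
  define y where "y = s * x"
  define h where "h = (\<lambda>n. inverse (real (Suc n)))"
  have h0: "h \<longlonglongrightarrow> 0" unfolding h_def by (rule LIMSEQ_inverse_real_of_nat)
  have hnz: "h n \<noteq> 0" for n by (simp add: h_def)
  have c: "(\<lambda>n. cis (h n * y)) \<longlonglongrightarrow> cis (0 * y)"
    by (intro tendsto_intros h0)
  have "((\<lambda>z. exp (\<i> * y * z)) has_field_derivative \<i> * y) (at (0::complex))"
    by (auto intro!: derivative_eq_intros)
  then have "((\<lambda>z. (exp (\<i> * y * z) - 1) / z) \<longlongrightarrow> \<i> * y) (at (0::complex))"
    by (simp add: has_field_derivative_iff)
  moreover have "filterlim (\<lambda>n. complex_of_real (h n)) (at 0) sequentially"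
    using h0 hnz by (simp add: filterlim_at tendsto_of_real_iff[where c = 0, simplified])
  ultimately have "(\<lambda>n. (exp (\<i> * y * h n) - 1) / h n) \<longlonglongrightarrow> \<i> * y"
    by (rule filterlim_compose)
  then have d: "(\<lambda>n. (cis (h n * y) - 1) /\<^sub>R h n) \<longlonglongrightarrow> \<i> * complex_of_real y"
    by (simp add: cis_conv_exp scaleR_conv_of_real field_simps)
  \<comment> \<open>Dividing numerator and denominator of the approximating function by
    \<open>h n\<close> gives this form, which contains \<open>h n\<close> only through a character
    and a difference quotient of \<open>exp\<close> at 0.\<close>
  have "(\<lambda>n. 1 / (cis (h n * y) - (cis (h n * y) - 1) /\<^sub>R h n)) \<longlonglongrightarrow> 1 / (cis (0 * y) - \<i> * complex_of_real y)"
    by (intro tendsto_intros c d) (auto simp: complex_eq_iff)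
  moreover have "1 / (cis (h n * y) - (cis (h n * y) - 1) /\<^sub>R h n)
      = complex_of_real (h n) * (1 / (1 - complex_of_real (1 - h n) * cis (h n * y)))" for n
  proof -
    have "cis (h n * y) - (cis (h n * y) - 1) /\<^sub>R h n
        = (1 - complex_of_real (1 - h n) * cis (h n * y)) / complex_of_real (h n)"
      using hnz[of n] by (simp add: scaleR_conv_of_real field_simps)
    then show ?thesis by simp
  qed
  ultimately show "(\<lambda>n. complex_of_real (inverse (real (Suc n)))
          * (1 / (1 - complex_of_real (1 - inverse (real (Suc n))) * cis (inverse (real (Suc n)) * s * x))))
      \<longlonglongrightarrow> 1 / (1 - \<i> * complex_of_real (s * x))"
    by (simp add: h_def y_def mult_ac)
qed

text \<open>Averaging the transforms for \<open>s\<close> and \<open>- s\<close> symmetrizes the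
  exponential density to the Laplace density.\<close>

lemma character_cone_laplace:
  "character_cone (\<lambda>x. complex_of_real (1 / (1 + (s * x)\<^sup>2)))"
proof -
  have "character_cone (\<lambda>x. complex_of_real (1/2) * (1 / (1 - \<i> * complex_of_real (s * x))
          + 1 / (1 - \<i> * complex_of_real (- s * x))))"
    by (intro character_cone.scale character_cone.add character_cone_exponential) auto
  moreover have "complex_of_real (1/2) * (1 / (1 - \<i> * complex_of_real (s * x))
          + 1 / (1 - \<i> * complex_of_real (- s * x))) = complex_of_real (1 / (1 + (s * x)\<^sup>2))" for x
  proof -
    have nz: "1 - \<i> * complex_of_real y \<noteq> 0" for y by (auto simp: complex_eq_iff)
    have "1 + \<i> * complex_of_real (s * x) \<noteq> 0" using nz[of "- (s * x)"] by simp
    moreover have "complex_of_real (1 + (s * x)\<^sup>2)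
        = (1 - \<i> * complex_of_real (s * x)) * (1 + \<i> * complex_of_real (s * x))"
      by (simp add: algebra_simps power2_eq_square)
    ultimately show ?thesis using nz[of "s * x"]
      by (simp only: of_real_divide of_real_1) (simp add: divide_simps)
  qed
  ultimately show ?thesis by (simp only:)
qed

section \<open>Quotients of hyperbolic sines\<close>

text \<open>Polymorphic, so that the real function and its entire extension, whose imaginary zeros
  decide necessity, share one definition.\<close>

definition sinhc :: "'a::{real_normed_field,banach} \<Rightarrow> 'a" where
  "sinhc z = (if z = 0 then 1 else sinh z / z)"

lemma sinhc_0 [simp]: "sinhc 0 = 1"
  by (simp add: sinhc_def)

lemma sinhc_of_real: "sinhc (of_real x :: complex) = of_real (sinhc x)"
  by (simp add: sinhc_def sinh_field_def exp_of_real flip: of_real_minus)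

lemma sinhc_pos: "sinhc (x::real) > 0"
  by (auto simp: sinhc_def zero_less_divide_iff)

lemma sinhc_ne_0 [simp]: "sinhc (x::real) \<noteq> 0"
  using sinhc_pos[of x] by simp

lemma mult_sinhc: "z * sinhc z = sinh z"
  by (simp add: sinhc_def)

text \<open>\<open>sinhc\<close> is the difference quotient of \<open>sinh\<close> at 0, and the
  value 1 there is the derivative, so the singularity is removable.\<close>

lemma holomorphic_on_sinhc: "sinhc holomorphic_on A"
proof -
  have d: "(sinh has_field_derivative 1) (at (0::complex))"
    by (auto intro!: derivative_eq_intros simp: sinh_field_def[abs_def])
  have "(sinh::complex \<Rightarrow> complex) holomorphic_on UNIV"
    unfolding sinh_field_def[abs_def] by (auto intro!: holomorphic_intros)
  then have "(\<lambda>z::complex. if z = 0 then deriv sinh 0 else (sinh z - sinh 0) / (z - 0)) holomorphic_on UNIV"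
    by (rule pole_lemma) simp
  also have "(\<lambda>z::complex. if z = 0 then deriv sinh 0 else (sinh z - sinh 0) / (z - 0)) = sinhc"
    using DERIV_imp_deriv[OF d] by (auto simp: sinhc_def)
  finally show ?thesis by (rule holomorphic_on_subset) simp
qed

lemma isCont_sinhc: "isCont sinhc (x::real)"
proof -
  have "continuous_on UNIV (sinhc :: complex \<Rightarrow> complex)"
    by (intro holomorphic_on_imp_continuous_on holomorphic_on_sinhc)
  then have "continuous_on UNIV (\<lambda>x. Re (sinhc (complex_of_real x)))"
    by (rule continuous_on_Re[OF continuous_on_compose2[OF _ continuous_on_of_real_id]]) simp
  then show ?thesis
    by (simp add: sinhc_of_real continuous_on_eq_continuous_at)
qed

lemma sinhc_product:
  "(\<lambda>n. \<Prod>k=1..n. 1 + (x / (pi * real k))\<^sup>2) \<longlonglongrightarrow> sinhc x"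
proof (cases "x = 0")
  case False
  \<comment> \<open>In the sine product at \<open>w / pi\<close> the imaginary factor turns the sine
    into a hyperbolic sine and every minus sign into a plus.\<close>
  define w where "w = \<i> * complex_of_real x"
  have "(\<lambda>n. of_real pi * (w / pi) * (\<Prod>k=1..n. 1 - (w / pi)\<^sup>2 / of_nat k ^ 2) / w)
          \<longlonglongrightarrow> sin (of_real pi * (w / pi)) / w"
    using False by (intro tendsto_divide sin_product_formula_complex tendsto_const) (auto simp: w_def)
  moreover have "sin (of_real pi * (w / pi)) / w = complex_of_real (sinhc x)"
    using False
    by (simp add: w_def flip: sinhc_of_real) (simp add: sinhc_def sinh_conv_sin field_simps)
  moreover have "of_real pi * (w / pi) * (\<Prod>k=1..n. 1 - (w / pi)\<^sup>2 / of_nat k ^ 2) / w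
      = complex_of_real (\<Prod>k=1..n. 1 + (x / (pi * real k))\<^sup>2)" for n
    using False by (simp add: w_def power_mult_distrib power_divide)
  ultimately show ?thesis
    by (simp only: tendsto_of_real_iff)
qed simp

lemma character_cone_sinhc_quotient:
  assumes "0 \<le> a" "a \<le> b"
  shows "character_cone (\<lambda>x. complex_of_real (sinhc (a * x) / sinhc (b * x)))"
proof (cases "b = 0")
  case True
  then show ?thesis using assms character_cone_const[of 1] by simp
next
  case False
  show ?thesis
  proof (rule character_cone.limit)
    fix n :: nat
    \<comment> \<open>The quotient of the \<open>k\<close>-th factors is a convex combination of 1
      and a Laplace transform, with weight \<open>(a / b)\<^sup>2\<close> on 1. For
      \<open>k = 0\<close> division by zero yields 0 and both sides equal 1, so the claim can be
      stated for all \<open>k\<close>.\<close>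
    have 1: "character_cone (\<lambda>x. complex_of_real ((a / b)\<^sup>2)
        + complex_of_real (1 - (a / b)\<^sup>2) * complex_of_real (1 / (1 + (b / (pi * real k) * x)\<^sup>2)))" for k
      using assms False
      by (intro character_cone.add character_cone_const character_cone.scale character_cone_laplace)
         (auto simp: power_le_one_iff)
    have "(1 + (a * x / (pi * real k))\<^sup>2) / (1 + (b * x / (pi * real k))\<^sup>2)
        = (a / b)\<^sup>2 + (1 - (a / b)\<^sup>2) * (1 / (1 + (b / (pi * real k) * x)\<^sup>2))" for x k
    proof -
      have p: "1 + (b / (pi * real k) * x)\<^sup>2 \<noteq> 0" 
        using zero_le_power2[of "b / (pi * real k) * x"] by linarith
      have "(a * x / (pi * real k))\<^sup>2 = (a / b)\<^sup>2 * (b / (pi * real k) * x)\<^sup>2"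
        using False by (simp add: power_mult_distrib power_divide)
      moreover have "(b * x / (pi * real k))\<^sup>2 = (b / (pi * real k) * x)\<^sup>2" by simp
      moreover have "(1 + q * y) / (1 + y) = q + (1 - q) * (1 / (1 + y))" if "1 + y \<noteq> 0" for q y :: real
        using that by (simp add: field_simps)
      ultimately show ?thesis using p by (simp only:)
    qed
    then have "character_cone (\<lambda>x. complex_of_real ((1 + (a * x / (pi * real k))\<^sup>2) / (1 + (b * x / (pi * real k))\<^sup>2)))" for k
      using 1[of k] by simp
    from character_cone_prod[OF this]
    show "character_cone (\<lambda>x. complex_of_real ((\<Prod>k=1..n. 1 + (a * x / (pi * real k))\<^sup>2) / (\<Prod>k=1..n. 1 + (b * x / (pi * real k))\<^sup>2)))"
      by (simp add: prod_dividef)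
  next
    fix x
    show "(\<lambda>n. complex_of_real ((\<Prod>k=1..n. 1 + (a * x / (pi * real k))\<^sup>2) / (\<Prod>k=1..n. 1 + (b * x / (pi * real k))\<^sup>2)))
        \<longlonglongrightarrow> complex_of_real (sinhc (a * x) / sinhc (b * x))"
      by (intro tendsto_of_real tendsto_divide sinhc_product sinhc_ne_0)
  qed
qed

text \<open>The identity \<open>sinh a sinh d - sinh b sinh (a + d - b) = sinh (a - b) sinh (d - b)\<close>, read as a
  reduction of \<open>(a, d)\<close> to \<open>(a - b, d - b)\<close> with the same denominator.\<close>

lemma sinhc_quotient_step:
  fixes a d b x :: real
  assumes "b > 0" "a > b" "d > b"
  shows "sinhc (a * x) * sinhc (d * x) / (sinhc (b * x) * sinhc ((a + d - b) * x))
    = b * (a + d - b) / (a * d) + (a - b) * (d - b) / (a * d) *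
        (sinhc ((a - b) * x) * sinhc ((d - b) * x) / (sinhc (b * x) * sinhc ((a + d - b) * x)))"
proof -
  have nz: "a \<noteq> 0" "d \<noteq> 0" using assms by auto
  have hyp: "sinh (a * x) * sinh (d * x)
      = sinh (b * x) * sinh ((a + d - b) * x) + sinh ((a - b) * x) * sinh ((d - b) * x)"
  proof -
    have p: "sinh u * sinh v = (cosh (u + v) - cosh (u - v)) / 2" for u v :: real
      by (simp add: cosh_add cosh_diff)
    have e: "cosh (b * x - (a + d - b) * x) = cosh ((a - b) * x + (d - b) * x)"
      using cosh_minus[of "b * x - (a + d - b) * x"] by (simp add: algebra_simps)
    show ?thesis unfolding p e by (simp add: field_simps)
  qed
  have "a * d * (sinhc (a * x) * sinhc (d * x)) = b * (a + d - b) * (sinhc (b * x) * sinhc ((a + d - b) * x))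
      + (a - b) * (d - b) * (sinhc ((a - b) * x) * sinhc ((d - b) * x))"
  proof (cases "x = 0")
    case True
    then show ?thesis by (simp add: algebra_simps)
  next
    case False
    have s: "sinh (t * x) = x * (t * sinhc (t * x))" for t
      using mult_sinhc[of "t * x"] by (simp add: mult_ac)
    from hyp[unfolded s] have "x * x * (a * d * (sinhc (a * x) * sinhc (d * x)))
      = x * x * (b * (a + d - b) * (sinhc (b * x) * sinhc ((a + d - b) * x))
      + (a - b) * (d - b) * (sinhc ((a - b) * x) * sinhc ((d - b) * x)))"
      by algebra
    then show ?thesis using False by simp
  qed
  then have "sinhc (a * x) * sinhc (d * x) = (b * (a + d - b) * (sinhc (b * x) * sinhc ((a + d - b) * x))
      + (a - b) * (d - b) * (sinhc ((a - b) * x) * sinhc ((d - b) * x))) / (a * d)"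
    using nz by (simp add: field_simps)
  then show ?thesis by (simp add: add_divide_distrib)
qed

definition sinhc_ratio :: "real \<Rightarrow> real \<Rightarrow> real \<Rightarrow> real \<Rightarrow> real \<Rightarrow> real" where
  "sinhc_ratio a d b c x = sinhc (a * x) * sinhc (d * x) / (sinhc (b * x) * sinhc (c * x))"

lemma sinhc_ratio_commute:
  "sinhc_ratio d a b c = sinhc_ratio a d b c" "sinhc_ratio a d c b = sinhc_ratio a d b c"
  by (simp_all add: sinhc_ratio_def[abs_def] mult.commute)

lemma character_cone_sinhc_ratio_split:
  assumes "0 \<le> a" "a \<le> b" "0 \<le> d" "d \<le> c"
  shows "character_cone (\<lambda>x. complex_of_real (sinhc_ratio a d b c x))"
  using character_cone_mult[OF character_cone_sinhc_quotient[OF assms(1,2)]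
                               character_cone_sinhc_quotient[OF assms(3,4)]]
  by (simp add: sinhc_ratio_def)

text \<open>Induction on the number of times \<open>b\<close> fits into \<open>a\<close>. Once one
  numerator parameter is at most \<open>b\<close>, it is paired with \<open>b\<close> and the other
  one with \<open>c\<close>.\<close>

lemma character_cone_sinhc_ratio_pos:
  assumes "0 < b" "0 \<le> a" "0 \<le> d" "a \<le> c" "d \<le> c" "a + d \<le> b + c"
  shows "character_cone (\<lambda>x. complex_of_real (sinhc_ratio a d b c x))"
  using assms
proof (induction "nat \<lfloor>a / b\<rfloor>" arbitrary: a d c rule: less_induct)
  case less
  consider "a \<le> b" | "d \<le> b" | "a > b" "d > b" by linarith
  then show ?case
  proof cases
    case 1
    then show ?thesis using less.prems by (intro character_cone_sinhc_ratio_split)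
  next
    case 2
    then have "character_cone (\<lambda>x. complex_of_real (sinhc_ratio d a b c x))"
      using less.prems by (intro character_cone_sinhc_ratio_split)
    then show ?thesis by (simp add: sinhc_ratio_commute)
  next
    case 3
    \<comment> \<open>The value of \<open>c\<close> for which the sum condition is an equality, as
      the reduction identity requires. Since \<open>c' \<le> c\<close>, a final factor
      \<open>sinhc (c' * x) / sinhc (c * x)\<close> passes from \<open>c'\<close> to
      \<open>c\<close>.\<close>
    define c' where "c' = a + d - b"
    have "(a - b) / b = a / b - 1" using \<open>0 < b\<close> by (simp add: diff_divide_distrib)
    moreover have "a / b > 1" using 3 \<open>0 < b\<close> by simp
    ultimately have "nat \<lfloor>(a - b) / b\<rfloor> < nat \<lfloor>a / b\<rfloor>"
      by (simp add: le_floor_iff)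
    then have "character_cone (\<lambda>x. complex_of_real (sinhc_ratio (a - b) (d - b) b c' x))"
      using less.prems 3 by (intro less.hyps) (auto simp: c'_def)
    then have "character_cone (\<lambda>x. complex_of_real (b * c' / (a * d))
        + complex_of_real ((a - b) * (d - b) / (a * d)) * complex_of_real (sinhc_ratio (a - b) (d - b) b c' x))"
      using less.prems 3
      by (intro character_cone.add character_cone.scale character_cone_const) (auto simp: c'_def)
    moreover have "complex_of_real (b * c' / (a * d))
        + complex_of_real ((a - b) * (d - b) / (a * d)) * complex_of_real (sinhc_ratio (a - b) (d - b) b c' x)
        = complex_of_real (sinhc_ratio a d b c' x)" for x
      using sinhc_quotient_step[OF \<open>0 < b\<close> 3, of x] unfolding sinhc_ratio_def c'_def
      by (simp only: of_real_add of_real_mult)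
    moreover have "character_cone (\<lambda>x. complex_of_real (sinhc (c' * x) / sinhc (c * x)))"
      using less.prems 3 by (intro character_cone_sinhc_quotient) (auto simp: c'_def)
    ultimately have "character_cone (\<lambda>x. complex_of_real (sinhc_ratio a d b c' x)
        * complex_of_real (sinhc (c' * x) / sinhc (c * x)))"
      by (intro character_cone_mult) simp_all
    then show ?thesis by (simp add: sinhc_ratio_def mult_ac)
  qed
qed

lemma character_cone_sinhc_ratio:
  assumes "0 \<le> b" "0 \<le> a" "0 \<le> d" "a \<le> c" "d \<le> c" "a + d \<le> b + c"
  shows "character_cone (\<lambda>x. complex_of_real (sinhc_ratio a d b c x))"
proof (rule character_cone.limit)
  fix n :: nat
  \<comment> \<open>Enlarging \<open>b\<close> only relaxes the sum condition, so the case of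
    positive \<open>b\<close> applies to each perturbed ratio.\<close>
  have "inverse (real (Suc n)) > 0" by simp
  then show "character_cone (\<lambda>x. complex_of_real (sinhc_ratio a d (b + inverse (real (Suc n))) c x))"
    using assms by (intro character_cone_sinhc_ratio_pos) linarith+
next
  fix x
  have "(\<lambda>n. (b + inverse (real (Suc n))) * x) \<longlonglongrightarrow> (b + 0) * x"
    by (intro tendsto_intros LIMSEQ_inverse_real_of_nat)
  then have "(\<lambda>n. sinhc ((b + inverse (real (Suc n))) * x)) \<longlonglongrightarrow> sinhc ((b + 0) * x)"
    by (rule isCont_tendsto_compose[OF isCont_sinhc])
  then have "(\<lambda>n. sinhc ((b + inverse (real (Suc n))) * x)) \<longlonglongrightarrow> sinhc (b * x)"
    by (simp only: add_0_right)
  then show "(\<lambda>n. complex_of_real (sinhc_ratio a d (b + inverse (real (Suc n))) c x))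
      \<longlonglongrightarrow> complex_of_real (sinhc_ratio a d b c x)"
    unfolding sinhc_ratio_def
    by (intro tendsto_of_real tendsto_divide tendsto_mult tendsto_const) simp_all
qed

section \<open>Necessary conditions\<close>

text \<open>Allows arbitrary finite index sets; the second difference below is indexed by pairs of a
  number and a truth value.\<close>

lemma positive_definite_finite_sum:
  assumes "positive_definite \<phi>" "finite I"
  shows "(\<Sum>i\<in>I. \<Sum>j\<in>I. \<alpha> i * cnj (\<alpha> j) * \<phi> (x i - x j)) \<in> \<real>\<^sub>\<ge>\<^sub>0"
proof (cases "I = {}")
  case False
  obtain h where h: "bij_betw h {1..card I} I"
    using ex_bij_betw_nat_finite_1[OF assms(2)] by blast
  have "card I \<ge> 1" using False assms(2) by (simp add: Suc_leI card_gt_0_iff)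
  then have "(\<Sum>i=1..card I. \<Sum>j=1..card I. \<alpha> (h i) * cnj (\<alpha> (h j)) * \<phi> (x (h i) - x (h j))) \<in> \<real>\<^sub>\<ge>\<^sub>0"
    using assms(1)[unfolded positive_definite_def, rule_format, of "card I" "\<lambda>i. \<alpha> (h i)" "\<lambda>i. x (h i)"] by simp
  then show ?thesis
    unfolding sum.reindex_bij_betw[OF h, of "\<lambda>j. \<alpha> (h i) * cnj (\<alpha> j) * \<phi> (x (h i) - x j)" for i]
      sum.reindex_bij_betw[OF h, of "\<lambda>i. \<Sum>j\<in>I. \<alpha> i * cnj (\<alpha> j) * \<phi> (x i - x j)"] .
qed simp

lemma positive_definite_at_0:
  assumes "positive_definite \<phi>"
  shows "\<phi> 0 \<in> \<real>\<^sub>\<ge>\<^sub>0"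
  using positive_definite_finite_sum[OF assms, of "{0::nat}" "\<lambda>_. 1" "\<lambda>_. 0"] by simp

text \<open>Double the points: \<open>x i\<close> gets weight \<alpha>, and its translate
  \<open>x i + h\<close> gets the opposite weight. Expanding the quadratic form of \<phi> over these
  points gives the form of the second difference.\<close>

lemma positive_definite_second_difference:
  assumes "positive_definite \<phi>"
  shows "positive_definite (\<lambda>x. 2 * \<phi> x - \<phi> (x + h) - \<phi> (x - h))"
  unfolding positive_definite_def
proof (intro allI impI)
  fix n :: nat and x :: "nat \<Rightarrow> real" and \<alpha> :: "nat \<Rightarrow> complex"
  have "(\<Sum>(i,p)\<in>{1..n}\<times>UNIV. \<Sum>(j,q)\<in>{1..n}\<times>UNIV. (if p then - \<alpha> i else \<alpha> i) * cnj (if q then - \<alpha> j else \<alpha> j)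
      * \<phi> ((x i + (if p then h else 0)) - (x j + (if q then h else 0)))) \<in> \<real>\<^sub>\<ge>\<^sub>0"
    using positive_definite_finite_sum[OF assms, of "{1..n}\<times>(UNIV :: bool set)"
        "\<lambda>(i,p). if p then - \<alpha> i else \<alpha> i" "\<lambda>(i,p). x i + (if p then h else 0)"]
    by (simp add: case_prod_unfold)
  moreover have "x i + h - x j = x i - x j + h" "x i - (x j + h) = x i - x j - h" 
      "x i + h - (x j + h) = x i - x j" for i j by auto
  ultimately show "(\<Sum>i=1..n. \<Sum>j=1..n. \<alpha> i * cnj (\<alpha> j)
      * (2 * \<phi> (x i - x j) - \<phi> (x i - x j + h) - \<phi> (x i - x j - h))) \<in> \<real>\<^sub>\<ge>\<^sub>0"
    by (simp add: sum.cartesian_product[symmetric] UNIV_bool sum.distrib sum_negf sum_subtractf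
        right_diff_distrib distrib_left mult.left_commute[of _ 2] sum_distrib_left[symmetric])
      (simp only: diff_conv_add_uminus add.assoc)
qed

text \<open>The second difference with step \<open>x\<close>, evaluated at 0, is
  nonnegative.\<close>

lemma positive_definite_even_le_at_0:
  assumes "positive_definite (\<lambda>x. complex_of_real (p x))" "p (- x) = p x"
  shows "p x \<le> p 0"
proof -
  have "complex_of_real (2 * p 0 - p x - p (- x)) \<in> \<real>\<^sub>\<ge>\<^sub>0"
    using positive_definite_at_0[OF positive_definite_second_difference[OF assms(1), of x]] by simp
  then show ?thesis using assms(2) by (simp only: nonneg_Reals_of_real_iff)
qed

lemma second_difference_quotient_tendsto:
  assumes holf: "f holomorphic_on S" and "open S" "z \<in> S"
  shows "((\<lambda>w. (f (z + w) + f (z - w) - 2 * f z) / w\<^sup>2) \<longlongrightarrow> deriv (deriv f) z) (at 0)"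
proof -
  obtain e where e: "e > 0" "cball z e \<subseteq> S"
    using open_contains_cball_eq[OF \<open>open S\<close>] \<open>z \<in> S\<close> by blast
  have "compact ((deriv ^^ 3) f ` cball z e)"
    using e holf \<open>open S\<close>
    by (intro compact_continuous_image compact_cball holomorphic_on_imp_continuous_on
        holomorphic_on_subset[OF holomorphic_higher_deriv])
  then obtain B where B: "\<And>u. u \<in> cball z e \<Longrightarrow> cmod ((deriv ^^ 3) f u) \<le> B"
    using compact_imp_bounded bounded_iff by (metis imageI)
  have taylor: "cmod (f (z + w) - (f z + deriv f z * w + deriv (deriv f) z * w\<^sup>2 / 2)) \<le> B * cmod w ^ 3 / 2"
    if "cmod w \<le> e" for w
  proof -
    have "cmod ((deriv ^^ 0) f (z + w) - (\<Sum>i\<le>2. (deriv ^^ i) f z * (z + w - z) ^ i / fact i))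
        \<le> B * cmod (z + w - z) ^ Suc 2 / fact 2"
    proof (rule complex_Taylor[where S = "cball z e"])
      fix i u assume "u \<in> cball z e"
      then have "u \<in> S" using e by blast
      then show "((deriv ^^ i) f has_field_derivative (deriv ^^ Suc i) f u) (at u within cball z e)"
        using holomorphic_derivI[OF holomorphic_higher_deriv[OF holf \<open>open S\<close>] \<open>open S\<close>]
        by (simp add: has_field_derivative_at_within)
    qed (use B e that in \<open>auto simp: dist_norm eval_nat_numeral\<close>)
    then show ?thesis by (simp add: eval_nat_numeral)
  qed
  have bound: "cmod ((f (z + w) + f (z - w) - 2 * f z) / w\<^sup>2 - deriv (deriv f) z) \<le> B * cmod w"
    if "w \<noteq> 0" "cmod w \<le> e" for w
  proof -
    \<comment> \<open>Adding the second-order expansions at \<open>w\<close> and \<open>- w\<close>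
      cancels the first-order terms and leaves a cubic error.\<close>
    have "cmod ((f (z + w) - (f z + deriv f z * w + deriv (deriv f) z * w\<^sup>2 / 2))
        + (f (z - w) - (f z - deriv f z * w + deriv (deriv f) z * w\<^sup>2 / 2))) \<le> B * cmod w ^ 3"
      using taylor[of w] taylor[of "- w"] that by (intro norm_triangle_le) simp
    also have "(f (z + w) - (f z + deriv f z * w + deriv (deriv f) z * w\<^sup>2 / 2))
        + (f (z - w) - (f z - deriv f z * w + deriv (deriv f) z * w\<^sup>2 / 2))
        = ((f (z + w) + f (z - w) - 2 * f z) / w\<^sup>2 - deriv (deriv f) z) * w\<^sup>2"
      using that by (simp add: field_simps)
    finally have "cmod ((f (z + w) + f (z - w) - 2 * f z) / w\<^sup>2 - deriv (deriv f) z) * cmod w ^ 2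
        \<le> (B * cmod w) * cmod w ^ 2"
      by (simp add: norm_mult norm_power eval_nat_numeral mult_ac)
    then show ?thesis using that by (simp add: mult_le_cancel_right)
  qed
  have "((\<lambda>w. (f (z + w) + f (z - w) - 2 * f z) / w\<^sup>2 - deriv (deriv f) z) \<longlongrightarrow> 0) (at 0)"
  proof (rule Lim_null_comparison)
    show "\<forall>\<^sub>F w in at 0. cmod ((f (z + w) + f (z - w) - 2 * f z) / w\<^sup>2 - deriv (deriv f) z) \<le> B * cmod w"
      unfolding eventually_at using e(1) bound by (intro exI[of _ e]) auto
    have "((\<lambda>w. B * cmod w) \<longlongrightarrow> B * cmod 0) (at 0)"
      by (intro tendsto_intros)
    then show "((\<lambda>w::complex. B * cmod w) \<longlongrightarrow> 0) (at 0)" by simp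
  qed
  then show ?thesis by (simp add: LIM_zero_iff)
qed

text \<open>Second differences divided by the squared step converge to minus the second derivative.
  The constant \<open>c\<close> carries the alternating sign when this is iterated.\<close>

lemma positive_definite_deriv2:
  assumes holf: "f holomorphic_on S" and "open S" "range complex_of_real \<subseteq> S"
    and pd: "positive_definite (\<lambda>x. c * f (complex_of_real x))"
  shows "positive_definite (\<lambda>x. - c * deriv (deriv f) (complex_of_real x))"
proof (rule positive_definite_limit)
  fix n :: nat
  show "positive_definite (\<lambda>x. complex_of_real (1 / (inverse (real (Suc n)))\<^sup>2) *
      (2 * (c * f (complex_of_real x)) - c * f (complex_of_real (x + inverse (real (Suc n))))
          - c * f (complex_of_real (x - inverse (real (Suc n))))))"
    by (intro positive_definite_scale positive_definite_second_difference[OF pd]) simp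
next
  fix x
  define h where "h = (\<lambda>n. inverse (real (Suc n)))"
  have "h \<longlonglongrightarrow> 0" unfolding h_def by (rule LIMSEQ_inverse_real_of_nat)
  then have "filterlim (\<lambda>n. complex_of_real (h n)) (at 0) sequentially"
    using tendsto_of_real_iff[of h 0 sequentially, where 'a = complex]
    by (simp add: filterlim_at) (simp add: h_def del: of_nat_Suc)
  moreover have "complex_of_real x \<in> S" using assms by auto
  ultimately have "(\<lambda>n. (f (x + h n) + f (x - h n) - 2 * f x) / (complex_of_real (h n))\<^sup>2)
      \<longlonglongrightarrow> deriv (deriv f) x"
    using filterlim_compose[OF second_difference_quotient_tendsto[OF holf \<open>open S\<close>]] by simp
  then have "(\<lambda>n. - c * ((f (x + h n) + f (x - h n) - 2 * f x) / (complex_of_real (h n))\<^sup>2))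
      \<longlonglongrightarrow> - c * deriv (deriv f) x"
    by (intro tendsto_intros)
  moreover have "- c * ((f (x + h n) + f (x - h n) - 2 * f x) / (complex_of_real (h n))\<^sup>2)
      = complex_of_real (1 / (h n)\<^sup>2) * (2 * (c * f x) - c * f (complex_of_real (x + h n))
          - c * f (complex_of_real (x - h n)))" for n
    by (simp add: field_simps h_def del: of_nat_Suc)
  ultimately show "(\<lambda>n. complex_of_real (1 / (inverse (real (Suc n)))\<^sup>2) *
      (2 * (c * f (complex_of_real x)) - c * f (complex_of_real (x + inverse (real (Suc n))))
          - c * f (complex_of_real (x - inverse (real (Suc n)))))) \<longlonglongrightarrow> - c * deriv (deriv f) (complex_of_real x)"
    unfolding h_def by (simp only:)
qed

lemma positive_definite_higher_deriv:
  assumes "f holomorphic_on S" "open S" "range complex_of_real \<subseteq> S"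
    and "positive_definite (\<lambda>x. f (complex_of_real x))"
  shows "positive_definite (\<lambda>x. (-1) ^ k * (deriv ^^ (2 * k)) f (complex_of_real x))"
proof (induction k)
  case 0
  then show ?case using assms by simp
next
  case (Suc k)
  show ?case
    using positive_definite_deriv2[OF holomorphic_higher_deriv[OF assms(1,2)] assms(2,3) Suc] by simp
qed

text \<open>In the sum of the two power series odd terms cancel, and the sign of
  \<open>(\<i> * y) ^ (2 * k)\<close> matches that of the derivative of order \<open>2 * k\<close>
  at 0. All terms are therefore nonnegative and the constant term is 2.\<close>

lemma positive_definite_imaginary_axis_nonzero:
  assumes holf: "f holomorphic_on S" and "open S" "range complex_of_real \<subseteq> S" "ball 0 r \<subseteq> S"
    and pd: "positive_definite (\<lambda>x. f (complex_of_real x))" and "f 0 = 1" "\<bar>y\<bar> < r"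
  shows "f (\<i> * y) + f (- (\<i> * y)) \<noteq> 0"
proof -
  define t where "t = (\<lambda>n. (deriv ^^ n) f 0 / fact n * (\<i> * y) ^ n + (deriv ^^ n) f 0 / fact n * (- (\<i> * y)) ^ n)"
  have ball: "f holomorphic_on ball 0 r" using holf assms(4) by (rule holomorphic_on_subset)
  have "t sums (f (\<i> * y) + f (- (\<i> * y)))"
    unfolding t_def
    using holomorphic_power_series[OF ball, of "\<i> * y"] holomorphic_power_series[OF ball, of "- (\<i> * y)"] \<open>\<bar>y\<bar> < r\<close>
    by (intro sums_add) (simp_all add: norm_mult)
  then have sums: "(\<lambda>n. Re (t n)) sums Re (f (\<i> * y) + f (- (\<i> * y)))" by (rule sums_Re)
  have nonneg: "Re (t n) \<ge> 0" for n
  proof (cases "even n")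
    case True
    then obtain k where k: "n = 2 * k" by blast
    have "(-1) ^ k * (deriv ^^ (2 * k)) f 0 \<in> \<real>\<^sub>\<ge>\<^sub>0"
      using positive_definite_at_0[OF positive_definite_higher_deriv[OF assms(1-3) pd, of k]] by simp
    then have "complex_of_real (2 * y ^ (2 * k) / fact (2 * k)) * ((-1) ^ k * (deriv ^^ (2 * k)) f 0) \<in> \<real>\<^sub>\<ge>\<^sub>0"
      by (intro nonneg_Reals_mult_of_real) (auto simp: zero_le_even_power)
    moreover have "t n = complex_of_real (2 * y ^ (2 * k) / fact (2 * k)) * ((-1) ^ k * (deriv ^^ (2 * k)) f 0)"
      by (simp add: t_def k power_mult power_mult_distrib power_minus[of "(complex_of_real y)\<^sup>2"])
    ultimately show ?thesis by (simp only: complex_nonneg_Reals_iff)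
  next
    case False
    then show ?thesis by (simp add: t_def)
  qed
  \<comment> \<open>Compare with the series that keeps only the constant term
    \<open>2 * f 0\<close>.\<close>
  have "(\<lambda>n. if n = 0 then 2 else 0 :: real) sums 2"
    using sums_single[of 0 "\<lambda>_. 2 :: real"] by simp
  then have "2 \<le> Re (f (\<i> * y) + f (- (\<i> * y)))"
    using nonneg by (intro sums_le[OF _ _ sums]) (auto simp: t_def \<open>f 0 = 1\<close>)
  then show ?thesis by (metis not_numeral_le_zero zero_complex.simps(1))
qed

section \<open>Zeros and growth of \<open>sinhc\<close>\<close>

lemma sinhc_minus [simp]: "sinhc (- z) = sinhc z"
  by (simp add: sinhc_def)

text \<open>A zero is an integer multiple of i pi; the multiple 0 is excluded by the value 1 there,
  so its modulus is at least pi.\<close>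

lemma sinhc_ne_0_complex:
  assumes "cmod z < pi"
  shows "sinhc z \<noteq> 0"
proof
  assume z: "sinhc z = 0"
  then have "z \<noteq> 0" by auto
  have "sin (\<i> * z) = 0" using mult_sinhc[of z] z by (simp add: sinh_conv_sin)
  then obtain n :: int where n: "\<i> * z = of_real (n * pi)" by (auto simp: Complex_Transcendental.sin_eq_0)
  then have "n \<noteq> 0" using \<open>z \<noteq> 0\<close> by auto
  have "cmod z = cmod (\<i> * z)" by (simp add: norm_mult)
  also have "\<dots> = \<bar>of_int n\<bar> * pi" unfolding n by (simp only: norm_of_real abs_mult) simp
  also have "\<dots> \<ge> 1 * pi" using \<open>n \<noteq> 0\<close> by (intro mult_right_mono) (linarith, simp)
  finally show False using assms by simp
qed

lemma sinhc_i_pi: "sinhc (\<i> * complex_of_real pi) = 0"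
  by (simp add: sinhc_def sinh_conv_sin flip: mult.assoc)

lemma sinhc_le_exp:
  assumes "y \<ge> 0" shows "sinhc (y::real) \<le> exp y"
proof (cases "y = 0")
  case False
  have "exp y * (1 - 2 * y) \<le> exp y * exp (- 2 * y)"
    using exp_ge_add_one_self[of "- 2 * y"] by (intro mult_left_mono) auto
  also have "\<dots> = exp (- y)" by (simp flip: exp_add)
  finally show ?thesis using False assms by (simp add: sinhc_def sinh_field_def field_simps)
qed simp

lemma exp_le_sinhc:
  assumes "y \<ge> 0" shows "exp y \<le> (1 + 2 * y) * sinhc (y::real)"
proof (cases "y = 0")
  case False
  have "exp (- y) * (1 + 2 * y) \<le> exp (- y) * exp (2 * y)"
    using exp_ge_add_one_self[of "2 * y"] by (intro mult_left_mono) auto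
  also have "\<dots> = exp y" by (simp flip: exp_add)
  finally show ?thesis using False assms by (simp add: sinhc_def sinh_field_def field_simps)
qed simp

lemma exp_le_square_imp_nonpos:
  fixes e K :: real
  assumes "\<And>x. x \<ge> 0 \<Longrightarrow> exp (e * x) \<le> (1 + K * x)\<^sup>2" "K \<ge> 0"
  shows "e \<le> 0"
proof (rule ccontr)
  assume "\<not> e \<le> 0"
  then have e: "e > 0" by simp
  \<comment> \<open>Chosen so that \<open>e * x / 3 = L\<^sup>2\<close> and
    \<open>K * x \<le> L ^ 3\<close>. Then the right side is at most
    \<open>L\<^sup>2 * (1 + L\<^sup>2)\<^sup>2\<close>, while the left side is at least
    \<open>(1 + L\<^sup>2) ^ 3\<close>.\<close>
  define L where "L = 1 + 3 * K / e"
  define x where "x = 3 * L\<^sup>2 / e"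
  have L: "L \<ge> 1" "K \<le> L * e / 3" using e assms(2) by (auto simp: L_def field_simps)
  have x: "x \<ge> 0" "e * x / 3 = L\<^sup>2" using e by (auto simp: x_def)
  have "(1 + K * x)\<^sup>2 \<le> (L * (1 + L\<^sup>2))\<^sup>2"
  proof (rule power_mono)
    have "K * x \<le> L * e / 3 * x" using L x by (intro mult_right_mono) auto
    also have "\<dots> = L * L\<^sup>2" using x(2) by (simp add: mult_ac)
    finally show "1 + K * x \<le> L * (1 + L\<^sup>2)" using L by (simp add: distrib_left)
  qed (use x assms in auto)
  also have "\<dots> < (1 + L\<^sup>2) ^ 3"
  proof -
    have "L\<^sup>2 * (1 + L\<^sup>2)\<^sup>2 < (1 + L\<^sup>2) * (1 + L\<^sup>2)\<^sup>2"
      using add_pos_nonneg[of 1 "L\<^sup>2"] by (intro mult_strict_right_mono zero_less_power) simp_all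
    then show ?thesis by (simp add: power_mult_distrib eval_nat_numeral mult_ac)
  qed
  also have "\<dots> \<le> exp (e * x / 3) ^ 3"
    using exp_ge_add_one_self[of "e * x / 3"] x by (intro power_mono) auto
  also have "\<dots> = exp (e * x)" by (simp flip: exp_of_nat_mult)
  finally show False using assms(1)[OF x(1)] by simp
qed

text \<open>The ratio is even, hence at most its value 1 at 0. Bounding each \<open>sinhc\<close> by
  an exponential, up to linear factors, leaves an exponential dominated by a square of a linear
  function.\<close>

lemma positive_definite_sinhc_ratio_imp_sum_le:
  assumes "0 \<le> a" "0 \<le> d" "0 \<le> b" "0 \<le> c"
    and pd: "positive_definite (\<lambda>x. complex_of_real (sinhc_ratio a d b c x))"
  shows "a + d \<le> b + c"
proof -
  have "exp ((a + d - b - c) * x) \<le> (1 + 2 * (a + d) * x)\<^sup>2" if "x \<ge> 0" for x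
  proof -
    have "sinhc_ratio a d b c x \<le> sinhc_ratio a d b c 0"
      by (rule positive_definite_even_le_at_0[OF pd]) (simp add: sinhc_ratio_def)
    then have "sinhc (a * x) * sinhc (d * x) \<le> sinhc (b * x) * sinhc (c * x)"
      using sinhc_pos[of "b * x"] sinhc_pos[of "c * x"] by (simp add: sinhc_ratio_def)
    also have "\<dots> \<le> exp (b * x) * exp (c * x)"
      using assms that by (intro mult_mono sinhc_le_exp) (auto intro: less_imp_le sinhc_pos)
    finally have le: "sinhc (a * x) * sinhc (d * x) \<le> exp (b * x) * exp (c * x)" .
    have "exp (a * x) * exp (d * x) \<le> ((1 + 2 * (a * x)) * sinhc (a * x)) * ((1 + 2 * (d * x)) * sinhc (d * x))"
      using assms that by (intro mult_mono exp_le_sinhc) (auto intro!: mult_nonneg_nonneg less_imp_le[OF sinhc_pos])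
    also have "\<dots> = ((1 + 2 * (a * x)) * (1 + 2 * (d * x))) * (sinhc (a * x) * sinhc (d * x))"
      by (simp add: mult_ac)
    also have "\<dots> \<le> (1 + 2 * (a + d) * x)\<^sup>2 * (exp (b * x) * exp (c * x))"
    proof (rule mult_mono[OF _ le])
      show "(1 + 2 * (a * x)) * (1 + 2 * (d * x)) \<le> (1 + 2 * (a + d) * x)\<^sup>2"
        unfolding power2_eq_square using assms that by (intro mult_mono) (auto simp: algebra_simps)
    qed (auto intro!: mult_nonneg_nonneg less_imp_le[OF sinhc_pos])
    finally show ?thesis by (simp add: left_diff_distrib distrib_right exp_add exp_diff field_simps)
  qed
  from exp_le_square_imp_nonpos[OF this] assms show ?thesis by simp
qed

lemma positive_definite_sinhc_ratio_imp_le_max: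
  assumes "0 \<le> b" "0 \<le> c"
    and pd: "positive_definite (\<lambda>x. complex_of_real (sinhc_ratio a d b c x))"
  shows "d \<le> max b c"
proof (rule ccontr)
  assume "\<not> d \<le> max b c"
  then have d: "d > b" "d > c" "d > 0" using assms by auto
  define f where "f = (\<lambda>z::complex. sinhc (a * z) * sinhc (d * z) / (sinhc (b * z) * sinhc (c * z)))"
  define S where "S = {z::complex. sinhc (b * z) * sinhc (c * z) \<noteq> 0}"
  \<comment> \<open>Since \<open>b\<close> and \<open>c\<close> are at most \<open>m\<close>, the
    denominator has no zero in the disc of radius \<open>pi / m\<close>; since \<open>m < d\<close>,
    the point i pi / d lies inside. The entry \<open>d / 2\<close> keeps \<open>m\<close> positive
    when \<open>b\<close> and \<open>c\<close> vanish.\<close>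
  define m where "m = max (max b c) (d / 2)"
  have m: "m > 0" "m < d" "b \<le> m" "c \<le> m" using d by (auto simp: m_def)
  have hol: "(\<lambda>z. sinhc (t * z)) holomorphic_on A" for t :: complex and A
    using holomorphic_on_compose[of "\<lambda>z. t * z" A sinhc] holomorphic_on_sinhc
    by (auto simp: o_def intro!: holomorphic_intros)
  have S1: "open S"
    unfolding S_def
    by (intro open_Collect_neq holomorphic_on_imp_continuous_on holomorphic_intros hol)
  have S2: "f holomorphic_on S"
    unfolding f_def S_def by (intro holomorphic_intros hol) auto
  have S3: "range complex_of_real \<subseteq> S"
    by (auto simp: S_def sinhc_of_real simp flip: of_real_mult)
  have S4: "ball 0 (pi / m) \<subseteq> S"
  proof
    fix z :: complex assume z: "z \<in> ball 0 (pi / m)"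
    then have z: "m * cmod z < pi" using m by (simp add: field_simps)
    have "cmod (t * z) < pi" if "0 \<le> t" "t \<le> m" for t
      using mult_right_mono[OF that(2), of "cmod z"] z that by (simp add: norm_mult)
    then show "z \<in> S" using assms m by (simp add: S_def sinhc_ne_0_complex)
  qed
  have "f (complex_of_real x) = complex_of_real (sinhc_ratio a d b c x)" for x
    by (simp add: f_def sinhc_ratio_def flip: sinhc_of_real)
  then have S5: "positive_definite (\<lambda>x. f (complex_of_real x))" using pd by simp
  have S6: "f 0 = 1" by (simp add: f_def)
  have S7: "\<bar>pi / d\<bar> < pi / m" using m d by (simp add: field_simps)
  have "f (\<i> * complex_of_real (pi / d)) + f (- (\<i> * complex_of_real (pi / d))) \<noteq> 0"
    by (rule positive_definite_imaginary_axis_nonzero[OF S2 S1 S3 S4 S5 S6 S7])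
  moreover have "sinhc (d * (\<i> * complex_of_real (pi / d))) = 0"
    using sinhc_i_pi d by simp
  ultimately show False by (simp add: f_def)
qed

lemma positive_definite_sinhc_ratio_iff:
  assumes "0 \<le> a" "0 \<le> d" "0 \<le> b" "0 \<le> c"
  shows "positive_definite (\<lambda>x. complex_of_real (sinhc_ratio a d b c x))
    \<longleftrightarrow> max a d \<le> max b c \<and> a + d \<le> b + c"
proof
  assume pd: "positive_definite (\<lambda>x. complex_of_real (sinhc_ratio a d b c x))"
  then have "positive_definite (\<lambda>x. complex_of_real (sinhc_ratio d a b c x))"
    by (simp add: sinhc_ratio_commute)
  then show "max a d \<le> max b c \<and> a + d \<le> b + c"
    using positive_definite_sinhc_ratio_imp_le_max pd assms
      positive_definite_sinhc_ratio_imp_sum_le by simp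
next
  assume le: "max a d \<le> max b c \<and> a + d \<le> b + c"
  have "character_cone (\<lambda>x. complex_of_real (sinhc_ratio a d b c x))"
  \<comment> \<open>The sufficiency lemma expects the larger denominator parameter in the last
    place.\<close>
  proof (cases "b \<le> c")
    case True
    then show ?thesis using le assms by (intro character_cone_sinhc_ratio) auto
  next
    case False
    then have "character_cone (\<lambda>x. complex_of_real (sinhc_ratio a d c b x))"
      using le assms by (intro character_cone_sinhc_ratio) auto
    then show ?thesis by (simp add: sinhc_ratio_commute)
  qed
  then show "positive_definite (\<lambda>x. complex_of_real (sinhc_ratio a d b c x))"
    by (rule character_cone_imp_positive_definite)
qed

section \<open>Translation back to \<open>fab\<close>\<close>

lemma powq_exp: "powq a (exp x) = exp (a * x / 2) * (x * sinhc (a / 2 * x))"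
proof (cases "a = 0")
  case False
  \<comment> \<open>Pulling out half of the exponent makes the numerator odd; with the factor
    \<open>x\<close> split off, the formula also covers \<open>a = 0\<close>.\<close>
  have "exp (a * x / 2) * (2 * sinh (a / 2 * x)) = exp (a * x) - 1"
    using mult_exp_exp[of "a * x / 2" "a * x / 2"] mult_exp_exp[of "a * x / 2" "- (a * x / 2)"]
    by (simp add: sinh_field_def field_simps)
  moreover have "2 * sinh (a / 2 * x) = a * (x * sinhc (a / 2 * x))"
    using mult_sinhc[of "a / 2 * x"] by simp
  ultimately have "exp (a * x) - 1 = a * (exp (a * x / 2) * (x * sinhc (a / 2 * x)))"
    by (metis mult.left_commute)
  then show ?thesis using False by (simp add: powq_def exp_powr_real mult.commute)
qed (simp add: powq_def)

text \<open>The exponent \<open>(1 - a + b) / 2\<close> cancels the exponentials from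
  \<open>powq_exp\<close>, leaving \<open>exp (x / 2)\<close>, which is the same for all parameters
  and drops out of quotients.\<close>

lemma fab_exp: "fab a b (exp x) = exp (x / 2) * (sinhc (a / 2 * x) / sinhc (b / 2 * x))"
proof (cases "x = 0")
  case False
  have "exp (x * ((1 - a + b) / 2)) * exp (a * x / 2) = exp (x / 2) * exp (b * x / 2)"
    by (simp add: field_simps flip: exp_add)
  then show ?thesis
    using False by (simp add: fab_def powq_exp exp_powr_real field_simps)
qed simp

lemma fab_preceq_iff:
  assumes "a \<ge> 0" "b \<ge> 0" "c \<ge> 0" "d \<ge> 0"
  shows "fab a b \<preceq> fab c d \<longleftrightarrow> max a d \<le> max b c \<and> a + d \<le> b + c"
proof -
  have "fab a b (exp x) / fab c d (exp x) = sinhc_ratio (a / 2) (d / 2) (b / 2) (c / 2) x" for x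
    by (simp add: fab_exp sinhc_ratio_def)
  then have "fab a b \<preceq> fab c d \<longleftrightarrow> max (a / 2) (d / 2) \<le> max (b / 2) (c / 2) \<and> a / 2 + d / 2 \<le> b / 2 + c / 2"
    using assms by (simp add: preceq_def positive_definite_sinhc_ratio_iff)
  also have "a / 2 + d / 2 \<le> b / 2 + c / 2 \<longleftrightarrow> a + d \<le> b + c" by linarith
  also have "max (a / 2) (d / 2) \<le> max (b / 2) (c / 2) \<longleftrightarrow> max a d \<le> max b c" by (simp add: max_def)
  finally show ?thesis .
qed

theorem theorem1p2:
  fixes a b c d :: real
  assumes "a \<ge> 0" and "b \<ge> 0" and "c \<ge> 0" and "d \<ge> 0"
  shows "(a > b \<longrightarrow>
            (fab a b \<preceq> fab c d \<longleftrightarrow>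
              (c, d) \<in> {(x, y). x \<ge> a \<and> 0 \<le> y \<and> y \<le> x - a + b})) \<and>
         (a \<le> b \<longrightarrow>
            (fab a b \<preceq> fab c d \<longleftrightarrow>
              (c, d) \<in> {(x, y). 0 \<le> x \<and> x \<le> y \<and> y \<le> x - a + b \<and> y \<le> b} \<union>
                       {(x, y). 0 \<le> y \<and> y \<le> x}))"
  \<comment> \<open>For \<open>a > b\<close> the maximum condition forces \<open>a \<le> c\<close>,
    and the sum condition then gives \<open>d < c\<close>. For \<open>a \<le> b\<close> both
    conditions hold if \<open>d \<le> c\<close>; if \<open>d > c\<close>, the maximum condition says
    \<open>d \<le> b\<close>.\<close>
  unfolding fab_preceq_iff[OF assms] using assms by (auto simp: max_def)

end
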